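(* For integers $\ell,n\ge0$ let $B(1;2,3,3;\ell,n)$ be the number of partitions $\pi=(\pi_1,\dots,\pi_\ell)$ of $n$ with exactly $\ell$ parts such that (i) no odd part is repeated; (ii) $\pi_i\ge \pi_{i+2}+2$ for $1\le i\le \ell-2$, with strict inequality if $\pi_i$ is even; (iii) at most $2$ parts are less than or equal to $2$. Then, for $|q|<1$, \[\sum_{\ell,n\ge0}B(1;2,3,3;\ell,n)\,x^\ell q^n=\sum_{N_1\ge N_2\ge 0}\frac{q^{2(N_1^2+N_2^2)}\,(-xq^{1+2N_2};q^2)_\infty\, x^{N_1+N_2}}{(q^2;q^2)_{N_1-N_2}\,(q^2;q^2)_{N_2}}.\]
   Context: $(a;q)_\infty=\prod_{i\ge0}(1-aq^i)$ and $(a;q)_n=(a;q)_\infty/(aq^n;q)_\infty$. *)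

theory Defs
  imports "HOL-Analysis.Analysis"
begin

definition qpoch_inf :: "complex \<Rightarrow> complex \<Rightarrow> complex" where
  "qpoch_inf a q = (\<Prod>i. (1 - a * q ^ i))"

definition qpoch :: "complex \<Rightarrow> complex \<Rightarrow> nat \<Rightarrow> complex" where
  "qpoch a q n = qpoch_inf a q / qpoch_inf (a * q ^ n) q"

definition B_set :: "nat \<Rightarrow> nat \<Rightarrow> nat list set" where
  "B_set l n = {p. length p = l \<and> sum_list p = n \<and> (\<forall>x\<in>set p. 0 < x)
     \<and> sorted_wrt (\<ge>) p
     \<and> (\<forall>k. odd k \<longrightarrow> count_list p k \<le> 1)
     \<and> (\<forall>i. i + 2 < l \<longrightarrow> p ! i \<ge> p ! (i + 2) + 2
                          \<and> (even (p ! i) \<longrightarrow> p ! i > p ! (i + 2) + 2))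
     \<and> length (filter (\<lambda>x. x \<le> 2) p) \<le> 2}"

definition B :: "nat \<Rightarrow> nat \<Rightarrow> nat" where
  "B l n = card (B_set l n)"

end

theory Submission
  imports Defs
begin

text \<open>
  Let \<open>G\<^sub>k(x)\<close> be the generating function of the partitions with at most \<open>k\<close> parts \<open>\<le> 2\<close>.
  Removing the parts \<open>\<le> 2\<close> and subtracting 2 from the others gives
  \<open>G\<^sub>0(x) = G\<^sub>2(x q^2)\<close>,
  \<open>G\<^sub>1(x) = G\<^sub>0(x) + x q G\<^sub>0(x) + x q^2 G\<^sub>1(x q^2)\<close> and
  \<open>G\<^sub>2(x) = G\<^sub>1(x) + x^2 q^3 G\<^sub>1(x q^2) + x^2 q^4 G\<^sub>0(x q^2)\<close>,
  which determine the coefficients of \<open>x ^ l\<close> by induction on \<open>l\<close>. Expanding the infinite product on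
  the right-hand side by Euler's identity yields a threefold Nahm sum. Its shifted versions satisfy
  contiguous relations, obtained by inserting \<open>1 - q^(2 n)\<close> for one of the three summation indices,
  and suitable combinations of them solve the same three equations.
\<close>

section \<open>Partitions as ascending lists\<close>

text \<open>The lists are the reversals of those in \<^const>\<open>B_set\<close>, so that small parts come first. Condition
  (iii) with bound 2 is automatic for admissible lists; \<open>k < 2\<close> gives the refined classes.\<close>

fun admissible :: "nat list \<Rightarrow> bool" where
  "admissible [] \<longleftrightarrow> True"
| "admissible [a] \<longleftrightarrow> True"
| "admissible [a, b] \<longleftrightarrow> a \<le> b \<and> (a = b \<longrightarrow> even a)"
| "admissible (a # b # c # ys) \<longleftrightarrow> a \<le> b \<and> (a = b \<longrightarrow> even a)
     \<and> a + 2 \<le> c \<and> (even c \<longrightarrow> a + 2 < c) \<and> admissible (b # c # ys)"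

definition parts :: "nat \<Rightarrow> nat \<Rightarrow> nat list set" where
  "parts k l = {ys. length ys = l \<and> admissible ys \<and> (\<forall>y\<in>set ys. 0 < y)
     \<and> length (filter (\<lambda>y. y \<le> 2) ys) \<le> k}"

lemma All_nat_Suc: "(\<forall>i. P i) \<longleftrightarrow> P 0 \<and> (\<forall>i. P (Suc i))"
  by (metis not0_implies_Suc)

text \<open>The recursion only inspects the three leading entries, so it suffices to see how each
  global condition changes when one entry is put in front. Since the list is ascending,
  \<open>ys ! (i + 2)\<close> is the larger part, and the parity in (ii) is tested there.\<close>

lemma admissible_iff:
  "admissible ys \<longleftrightarrow> sorted ys \<and> (\<forall>k. odd k \<longrightarrow> count_list ys k \<le> 1)
     \<and> (\<forall>i. i + 2 < length ys \<longrightarrow> ys ! i + 2 \<le> ys ! (i + 2)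
                          \<and> (even (ys ! (i + 2)) \<longrightarrow> ys ! i + 2 < ys ! (i + 2)))"
proof (induction ys rule: admissible.induct)
  case (3 a b)
  then show ?case by auto
next
  case (4 a b c ys)
  let ?Q = "\<lambda>(ys::nat list) i. ys ! i + 2 \<le> ys ! (i + 2)
                          \<and> (even (ys ! (i + 2)) \<longrightarrow> ys ! i + 2 < ys ! (i + 2))"
  let ?R = "\<lambda>ys. \<forall>i. i + 2 < length ys \<longrightarrow> ?Q ys i"
  let ?O = "\<lambda>ys::nat list. \<forall>k. odd k \<longrightarrow> count_list ys k \<le> 1"
  have R: "?R (a # b # c # ys) \<longleftrightarrow> a + 2 \<le> c \<and> (even c \<longrightarrow> a + 2 < c) \<and> ?R (b # c # ys)"
    using All_nat_Suc[of "\<lambda>i. i + 2 < length (a # b # c # ys) \<longrightarrow> ?Q (a # b # c # ys) i"] by simp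
  have S: "sorted (a # b # c # ys) \<longleftrightarrow> a \<le> b \<and> sorted (b # c # ys)"
    by auto
  \<comment> \<open>Once \<open>a + 2 \<le> c\<close> and the tail is sorted, \<open>b\<close> is
    the only later entry that can equal \<open>a\<close>. The ban on repeated odd parts thus reduces
    to comparing neighbours.\<close>
  have Oimp: "?O (a # b # c # ys) \<longleftrightarrow> (a = b \<longrightarrow> even a) \<and> ?O (b # c # ys)"
    if "a + 2 \<le> c" "sorted (b # c # ys)"
  proof -
    have "count_list (c # ys) a = 0"
      using that by (subst count_list_0_iff) force
    then have *: "count_list (b # c # ys) a = (if a = b then 1 else 0)"
      "\<And>k. count_list (a # b # c # ys) k = (if k = a then 1 else 0) + count_list (b # c # ys) k"
      by auto
    obtain f where f: "f = count_list (b # c # ys)" by blast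
    have "f a = (if a = b then 1 else 0)"
      using *(1) f by blast
    then have "(odd k \<longrightarrow> (if k = a then 1 else 0) + f k \<le> 1)
        \<longleftrightarrow> (k = a \<longrightarrow> a = b \<longrightarrow> even a) \<and> (odd k \<longrightarrow> f k \<le> 1)" for k
      by (cases "k = a"; cases "a = b") auto
    then show ?thesis
      unfolding *(2) f[symmetric] by blast
  qed
  show ?case
    unfolding R S admissible.simps(4) 4 using Oimp by blast
qed auto

section \<open>Shifting by 2 and prepending parts 1 and 2\<close>

lemma admissible_shift: "admissible (map (\<lambda>y. y + 2) ys) \<longleftrightarrow> admissible ys"
  by (induction ys rule: admissible.induct) auto

lemma sorted_admissible: "admissible ys \<Longrightarrow> sorted ys"
  by (simp add: admissible_iff)

lemma admissible_ConsD: "admissible (y # ys) \<Longrightarrow> admissible ys"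
  by (cases "y # ys" rule: admissible.cases) auto

lemma filter_shift: "filter (\<lambda>y. y \<le> 2) (map (\<lambda>y. y + 2) ys) = ([] :: nat list)"
  if "\<forall>y\<in>set ys. 0 < y"
  using that by (induction ys) auto

lemma unshift:
  fixes ys :: "nat list"
  assumes "\<forall>y\<in>set ys. 2 < y"
  obtains zs where "ys = map (\<lambda>y. y + 2) zs" "\<forall>z\<in>set zs. 0 < z"
proof
  show "ys = map (\<lambda>y. y + 2) (map (\<lambda>y. y - 2) ys)"
    using assms by (induction ys) auto
qed (use assms in auto)

text \<open>The new window demands that its third entry \<open>c\<close> be at least 3, and more
  than 3 if even. Every \<open>c > 2\<close> satisfies this: 3 is odd, and an even \<open>c\<close>
  is at least 4.\<close>

lemma admissible_1_Cons:
  assumes "\<forall>y\<in>set ys. 2 < y"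
  shows "admissible (1 # ys) \<longleftrightarrow> admissible ys"
proof (cases ys rule: admissible.cases)
  case (3 b c)
  then have "3 \<le> c \<and> (even c \<longrightarrow> 3 < c)"
    using assms by (cases "c = 3") auto
  then show ?thesis using assms 3 by auto
next
  case (4 b c d zs)
  then have "3 \<le> c \<and> (even c \<longrightarrow> 3 < c)"
    using assms by (cases "c = 3") auto
  then show ?thesis using assms 4 by auto
qed (use assms in auto)

lemma few_small_parts_iff:
  assumes "sorted (b # c # ys)"
  shows "length (filter (\<lambda>y. y \<le> 2) (b # c # ys)) \<le> 1 \<longleftrightarrow> (2::nat) < c"
proof -
  have "filter (\<lambda>y. y \<le> 2) ys = []" if "2 < c"
    using that assms by (force simp: filter_empty_conv)
  then show ?thesis
    using assms by auto
qed

text \<open>For unshifted leading entries \<open>b\<close>, \<open>c\<close> the new window requires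
  \<open>2 \<le> c\<close>, strictly if \<open>c\<close> is even, which amounts to
  \<open>2 < c\<close>. By \<open>few_small_parts_iff\<close> this says that \<open>ys\<close> has
  at most one part up to 2, so the class \<open>parts 1\<close> appears.\<close>

lemma admissible_2_Cons:
  assumes "\<forall>y\<in>set ys. 0 < y"
  shows "admissible (2 # map (\<lambda>y. y + 2) ys) \<longleftrightarrow>
           admissible ys \<and> length (filter (\<lambda>y. y \<le> 2) ys) \<le> 1"
proof (cases ys rule: admissible.cases)
  case (4 b c d zs)
  have "2 \<le> c \<and> (even c \<longrightarrow> 2 < c) \<longleftrightarrow> 2 < c"
    by presburger
  moreover have "admissible (2 # map (\<lambda>y. y + 2) ys) \<longleftrightarrow>
      2 \<le> c \<and> (even c \<longrightarrow> 2 < c) \<and> admissible (map (\<lambda>y. y + 2) ys)"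
    using 4 assms by auto
  ultimately show ?thesis
    unfolding admissible_shift
    using few_small_parts_iff[of b c "d # zs"] sorted_admissible[of ys] 4 by metis
next
  case (3 b c)
  have "2 \<le> c \<and> (even c \<longrightarrow> 2 < c) \<longleftrightarrow> 2 < c"
    by presburger
  then show ?thesis using assms 3 by auto
qed auto

text \<open>The window 1, 2, \<open>c + 2\<close> needs \<open>c + 2\<close> to be at least 3, and
  more than 3 if even; any positive \<open>c\<close> does, because 3 is odd.\<close>

lemma admissible_1_2_Cons:
  assumes "\<forall>y\<in>set ys. 0 < y"
  shows "admissible (1 # 2 # map (\<lambda>y. y + 2) ys) \<longleftrightarrow> admissible (2 # map (\<lambda>y. y + 2) ys)"
proof (cases ys)
  case (Cons c zs)
  then have "1 + 2 \<le> c + 2 \<and> (even (c + 2) \<longrightarrow> 1 + 2 < c + 2)"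
    using assms by (cases "c = 1") auto
  then show ?thesis
    unfolding Cons list.map admissible.simps(4) by auto
qed auto

text \<open>The window 2, 2, \<open>c + 2\<close> forces \<open>2 < c\<close> for the first entry
  \<open>c\<close> of \<open>ys\<close>, and sortedness extends the bound to all of
  \<open>ys\<close>.\<close>

lemma admissible_2_2_Cons:
  assumes "\<forall>y\<in>set ys. 0 < y"
  shows "admissible (2 # 2 # map (\<lambda>y. y + 2) ys) \<longleftrightarrow> admissible ys \<and> (\<forall>y\<in>set ys. 2 < y)"
proof (cases ys)
  case (Cons c zs)
  have "2 \<le> c \<and> (even c \<longrightarrow> 2 < c) \<longleftrightarrow> 2 < c"
    by presburger
  moreover have "length (filter (\<lambda>y. y \<le> 2) ys) \<le> 1 \<and> (\<forall>y\<in>set ys. 2 < y) \<longleftrightarrow> 2 < c" if "admissible ys"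
  proof -
    have "(\<forall>y\<in>set ys. 2 < y) \<longleftrightarrow> 2 < c"
      using sorted_admissible[OF that] Cons by auto
    moreover have "filter (\<lambda>y. y \<le> 2) ys = []" if "\<forall>y\<in>set ys. 2 < y"
      using that by (auto simp: filter_empty_conv)
    ultimately show ?thesis by (metis list.size(3) zero_le)
  qed
  ultimately show ?thesis
    using admissible_2_Cons[OF assms] Cons by auto
qed auto

section \<open>Decomposing the classes by their parts up to 2\<close>

lemma parts_0_iff:
  "ys \<in> parts 0 l \<longleftrightarrow> length ys = l \<and> admissible ys \<and> (\<forall>y\<in>set ys. 2 < y)"
  by (auto simp: parts_def filter_empty_conv not_le)

text \<open>The third entry exceeds the first, which is positive, by at least 2, so it and all later
  entries are above 2.\<close>

lemma length_small_parts_le_2: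
  assumes "admissible ys" "\<forall>y\<in>set ys. 0 < y"
  shows "length (filter (\<lambda>y. y \<le> 2) ys) \<le> 2"
proof (cases ys rule: admissible.cases)
  case (4 a b c zs)
  then have "2 < c" "sorted (c # zs)"
    using assms sorted_admissible[of ys] by auto
  then have "filter (\<lambda>y. y \<le> 2) (c # zs) = []"
    by (auto simp: filter_empty_conv)
  then show ?thesis using 4 by auto
qed auto

lemma parts_0: "parts 0 l = map (\<lambda>y. y + 2) ` parts 2 l"
proof (intro equalityI subsetI)
  fix ys assume "ys \<in> parts 0 l"
  then have *: "length ys = l" "admissible ys" "\<forall>y\<in>set ys. 2 < y"
    by (auto simp: parts_0_iff)
  from unshift[OF *(3)] obtain zs where zs: "ys = map (\<lambda>y. y + 2) zs" "\<forall>z\<in>set zs. 0 < z" .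
  then have "zs \<in> parts 2 l"
    using *(1,2) length_small_parts_le_2[of zs] unfolding zs(1) admissible_shift parts_def by simp
  then show "ys \<in> map (\<lambda>y. y + 2) ` parts 2 l"
    using zs by blast
next
  fix ys assume "ys \<in> map (\<lambda>y. y + 2) ` parts 2 l"
  then obtain zs where "ys = map (\<lambda>y. y + 2) zs" "zs \<in> parts 2 l" by blast
  then show "ys \<in> parts 0 l"
    unfolding parts_0_iff using admissible_shift[of zs] by (auto simp: parts_def)
qed

text \<open>The three pieces have no small part, the small part 1, or the small part 2. A leading 1
  leaves the remaining large parts unrestricted, so they need no shift; a leading 2 restricts them,
  and after subtracting 2 the restriction is membership in \<open>parts 1\<close>.\<close>

lemma parts_1_Suc:
  "parts 1 (Suc l) = parts 0 (Suc l) \<union> (Cons 1 ` parts 0 l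
     \<union> (\<lambda>ys. 2 # map (\<lambda>y. y + 2) ys) ` parts 1 l)" (is "?L = ?R")
proof (intro equalityI subsetI)
  fix ys assume ys: "ys \<in> ?L"
  then obtain a zs where a: "ys = a # zs"
    by (cases ys) (auto simp: parts_def)
  have adm: "admissible (a # zs)" "admissible zs" "sorted (a # zs)" "0 < a" "\<forall>y\<in>set zs. 0 < y" "length zs = l"
    using ys a admissible_ConsD[of a zs] sorted_admissible[of ys] by (auto simp: parts_def)
  show "ys \<in> ?R"
  proof (cases "2 < a")
    case True
    then show ?thesis
      using adm a by (force simp: parts_0_iff)
  next
    case False
    then have "filter (\<lambda>y. y \<le> 2) zs = []"
      using ys a by (auto simp: parts_def)
    then have big: "\<forall>y\<in>set zs. 2 < y"
      by (auto simp: filter_empty_conv not_le)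
    consider "a = 1" | "a = 2"
      using False adm by linarith
    then show ?thesis
    proof cases
      case 1
      then show ?thesis
        using a adm big by (auto simp: parts_0_iff)
    next
      case 2
      from unshift[OF big] obtain ws where ws: "zs = map (\<lambda>y. y + 2) ws" "\<forall>z\<in>set ws. 0 < z" .
      then have "ws \<in> parts 1 l"
        using adm admissible_2_Cons[OF ws(2)] 2 by (simp add: parts_def)
      then show ?thesis
        using ws a 2 by blast
    qed
  qed
next
  fix ys assume "ys \<in> ?R"
  then consider "ys \<in> parts 0 (Suc l)" | zs where "ys = 1 # zs" "zs \<in> parts 0 l"
    | zs where "ys = 2 # map (\<lambda>y. y + 2) zs" "zs \<in> parts 1 l"
    by blast
  then show "ys \<in> ?L"
  proof cases
    case 2
    then show ?thesis
      using admissible_1_Cons[of zs] by (auto simp: parts_0_iff) (auto simp: parts_def filter_empty_conv)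
  next
    case 3
    then show ?thesis
      using admissible_2_Cons[of zs] filter_shift[of zs] by (auto simp: parts_def)
  qed (auto simp: parts_def)
qed

text \<open>Two small parts can only be 1, 2 or 2, 2, since the odd part 1 may not be repeated.
  Subtracting 2 from the other parts leaves \<open>parts 1\<close> in the first case and
  \<open>parts 0\<close> in the second.\<close>

lemma parts_2_Suc_Suc:
  "parts 2 (Suc (Suc l)) = parts 1 (Suc (Suc l)) \<union> ((\<lambda>ys. 1 # 2 # map (\<lambda>y. y + 2) ys) ` parts 1 l
     \<union> (\<lambda>ys. 2 # 2 # map (\<lambda>y. y + 2) ys) ` parts 0 l)" (is "?L = ?R")
proof (intro equalityI subsetI)
  fix ys assume ys: "ys \<in> ?L"
  then obtain a b zs where a: "ys = a # b # zs"
    by (cases ys rule: admissible.cases) (auto simp: parts_def)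
  have adm: "admissible (a # b # zs)" "admissible (b # zs)" "sorted (a # b # zs)" "0 < a" 
      "a = b \<longrightarrow> even a" "\<forall>y\<in>set zs. 0 < y" "length zs = l"
    using ys a admissible_ConsD[of a "b # zs"] sorted_admissible[of ys] by (cases zs; auto simp: parts_def)+
  show "ys \<in> ?R"
  proof (cases "2 < b")
    case True
    then have "length (filter (\<lambda>y. y \<le> 2) ys) \<le> 1"
      using few_small_parts_iff adm a by blast
    then show ?thesis
      using ys by (auto simp: parts_def)
  next
    case False
    then have "filter (\<lambda>y. y \<le> 2) zs = []"
      using ys a adm by (auto simp: parts_def)
    then have big: "\<forall>y\<in>set zs. 2 < y"
      by (auto simp: filter_empty_conv not_le)
    from unshift[OF big] obtain ws where ws: "zs = map (\<lambda>y. y + 2) ws" "\<forall>z\<in>set ws. 0 < z" .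
    have "a \<le> b" using adm by simp
    then consider "a = 1" "b = 2" | "a = 2" "b = 2"
      using False adm(4,5) by (cases "a = 1"; cases "b = 1") auto
    then show ?thesis
    proof cases
      case 1
      then have "ws \<in> parts 1 l"
        using adm ws admissible_2_Cons[OF ws(2)] by (simp add: parts_def)
      then show ?thesis
        using 1 ws a by blast
    next
      case 2
      then have "ws \<in> parts 0 l"
        using adm ws admissible_2_2_Cons[OF ws(2)] by (simp add: parts_0_iff)
      then show ?thesis
        using 2 ws a by blast
    qed
  qed
next
  fix ys assume "ys \<in> ?R"
  then consider "ys \<in> parts 1 (Suc (Suc l))"
    | zs where "ys = 1 # 2 # map (\<lambda>y. y + 2) zs" "zs \<in> parts 1 l"
    | zs where "ys = 2 # 2 # map (\<lambda>y. y + 2) zs" "zs \<in> parts 0 l"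
    by blast
  then show "ys \<in> ?L"
  proof cases
    case 2
    then have "\<forall>z\<in>set zs. 0 < z" by (auto simp: parts_def)
    then show ?thesis
      using 2 admissible_1_2_Cons[of zs] admissible_2_Cons[of zs] filter_shift[of zs] by (auto simp: parts_def)
  next
    case 3
    then have "\<forall>z\<in>set zs. 0 < z" by (auto simp: parts_def)
    then show ?thesis
      using 3 admissible_2_2_Cons[of zs] filter_shift[of zs] by (auto simp: parts_0_iff) (auto simp: parts_def)
  qed (auto simp: parts_def)
qed

section \<open>Small lengths and the link with \<open>B_set\<close>\<close>

lemma parts_k_0: "parts k 0 = {[]}"
  by (auto simp: parts_def)

lemma parts_2_1: "parts 2 (Suc 0) = parts 1 (Suc 0)"
  by (auto simp: parts_def length_Suc_conv)

lemma mem_B_set_iff: "p \<in> B_set l n \<longleftrightarrow> rev p \<in> parts 2 l \<and> sum_list p = n"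
proof (cases "l = length p")
  case True
  let ?P = "\<lambda>x y :: nat. y + 2 \<le> x \<and> (even x \<longrightarrow> y + 2 < x)"
  \<comment> \<open>Reversal turns the window starting at \<open>i\<close> into the one starting at
    \<open>length p - Suc (i + 2)\<close> and swaps its ends.\<close>
  have triples: "(\<forall>i. i + 2 < length p \<longrightarrow> ?P (p ! i) (p ! (i + 2)))
      \<longleftrightarrow> (\<forall>i. i + 2 < length p \<longrightarrow> ?P (rev p ! (i + 2)) (rev p ! i))"
  proof (intro iffI allI impI)
    fix i assume *: "\<forall>i. i + 2 < length p \<longrightarrow> ?P (p ! i) (p ! (i + 2))" "i + 2 < length p"
    then have "length p - Suc (i + 2) + 2 < length p" "length p - Suc (i + 2) + 2 = length p - Suc i"
      by auto
    then show "?P (rev p ! (i + 2)) (rev p ! i)"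
      using *(1)[rule_format, of "length p - Suc (i + 2)"] *(2) by (simp add: rev_nth)
  next
    fix i assume *: "\<forall>i. i + 2 < length p \<longrightarrow> ?P (rev p ! (i + 2)) (rev p ! i)" "i + 2 < length p"
    then have "length p - Suc (i + 2) + 2 < length p" "length p - Suc (length p - Suc (i + 2) + 2) = i"
        "length p - Suc (length p - Suc (i + 2)) = i + 2"
      by auto
    then show "?P (p ! i) (p ! (i + 2))"
      using *(1)[rule_format, of "length p - Suc (i + 2)"] *(2) by (simp add: rev_nth)
  qed
  have small: "length (filter P (rev p)) = length (filter P p)" for P
    by (simp flip: rev_filter)
  have sort: "sorted (rev p) \<longleftrightarrow> sorted_wrt (\<ge>) p"
    by (simp add: sorted_wrt_rev)
  show ?thesis
    unfolding B_set_def parts_def admissible_iff mem_Collect_eq length_rev set_rev count_list_rev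
      True triples small sort
    by argo
qed (auto simp: B_set_def parts_def)

lemma B_set_eq: "B_set l n = rev ` {ys \<in> parts 2 l. sum_list ys = n}"
proof (intro equalityI subsetI)
  fix p assume "p \<in> B_set l n"
  then show "p \<in> rev ` {ys \<in> parts 2 l. sum_list ys = n}"
    by (intro image_eqI[of _ rev "rev p"]) (simp_all add: mem_B_set_iff)
qed (auto simp: mem_B_set_iff)

section \<open>Contiguous relations for a Nahm sum\<close>

text \<open>This is (q;q)_n as a finite product; \<open>qpoch_qq\<close> identifies it with the
  quotient of infinite products for |q| < 1.\<close>

definition qfac :: "complex \<Rightarrow> nat \<Rightarrow> complex" where
  "qfac q n = (\<Prod>i<n. 1 - q ^ Suc i)"

definition nterm :: "complex \<Rightarrow> nat \<Rightarrow> nat \<Rightarrow> nat \<Rightarrow> nat \<times> nat \<times> nat \<Rightarrow> complex" where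
  "nterm q i j k = (\<lambda>(a, b, m).
     q ^ m * (q\<^sup>2) ^ (a\<^sup>2 + 2 * a * b + 2 * b\<^sup>2 + m * b + (m choose 2) + i * a + j * b + k * m)
       / (qfac (q\<^sup>2) a * qfac (q\<^sup>2) b * qfac (q\<^sup>2) m))"

text \<open>The coefficient of \<open>x ^ l\<close> of the Nahm sum over \<open>a = N1 - N2\<close>, \<open>b = N2\<close> and the index \<open>m\<close>
  of Euler's expansion of \<open>(- x q^(1+2b); q^2)\<close> collects the triples with \<open>a + 2 b + m = l\<close>; the
  parameters \<open>i, j, k\<close> insert \<open>q^(2(i a + j b + k m))\<close>.\<close>

definition triples :: "nat \<Rightarrow> (nat \<times> nat \<times> nat) set" where
  "triples l = {(a, b, m). a + 2 * b + m = l}"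

definition nsum :: "complex \<Rightarrow> nat \<Rightarrow> nat \<Rightarrow> nat \<Rightarrow> nat \<Rightarrow> complex" where
  "nsum q i j k l = sum (nterm q i j k) (triples l)"

lemma qfac_0 [simp]: "qfac q 0 = 1"
  by (simp add: qfac_def)

lemma qfac_Suc [simp]: "qfac q (Suc n) = qfac q n * (1 - q ^ Suc n)"
  by (simp add: qfac_def)

lemma one_minus_power_neq_0:
  fixes q :: complex
  assumes "norm q < 1"
  shows "1 - q ^ Suc n \<noteq> 0"
proof -
  have "norm (q ^ Suc n) < 1"
    using assms by (simp add: norm_power power_less_one_iff del: power_Suc)
  then show ?thesis by auto
qed

lemma finite_triples: "finite (triples l)"
  by (rule finite_subset[of _ "{..l} \<times> {..l} \<times> {..l}"]) (auto simp: triples_def)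

lemma triples_0: "triples 0 = {(0, 0, 0)}"
  by (auto simp: triples_def)

lemma nsum_0 [simp]: "nsum q i j k 0 = 1"
  by (simp add: nsum_def triples_0 nterm_def binomial_eq_0)

text \<open>In the applications \<open>h\<close> raises one index by 1 and \<open>f\<close> carries
  a factor 1 - q^(2n) in that index n. This factor vanishes at n = 0, that is, off the image of
  \<open>h\<close>.\<close>

lemma sum_triples_eq:
  fixes f g :: "nat \<times> nat \<times> nat \<Rightarrow> complex"
  assumes "inj h" "h ` triples l' \<subseteq> triples l"
    and "\<And>t. t \<in> triples l \<Longrightarrow> t \<notin> h ` triples l' \<Longrightarrow> f t = 0"
    and "\<And>t. f (h t) = c * g t"
  shows "sum f (triples l) = c * sum g (triples l')"
proof -
  have "sum f (triples l) = sum f (h ` triples l')"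
    using assms finite_triples by (intro sum.mono_neutral_right) auto
  also have "\<dots> = (\<Sum>t\<in>triples l'. f (h t))"
    using assms(1) by (subst sum.reindex) (auto intro: inj_on_subset)
  finally show ?thesis
    by (simp only: assms(4) sum_distrib_left)
qed

context
  fixes q :: complex
  assumes q: "norm q < 1"
begin

section \<open>Contiguous relations in the three indices\<close>

lemma norm_q2: "norm (q\<^sup>2) < 1"
  using q by (simp add: norm_power power_less_one_iff abs_square_less_1)

text \<open>Raising a by 1 adds 2a + 2b + 1 + i to the exponent of q^2: the linear terms shift
  \<open>i\<close> and \<open>j\<close> by 2 and the constant goes in front. The factor on the left
  cancels the new factor of \<open>qfac\<close>. The lemmas for b and m work alike, with increments
  2a + 4b + m + 2 + j and b + m + k.\<close>

lemma nterm_Suc_a: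
  "nterm q i j k (Suc a, b, m) * (1 - (q\<^sup>2) ^ Suc a) = (q\<^sup>2) ^ (i + 1) * nterm q (i + 2) (j + 2) k (a, b, m)"
proof -
  define e where "e = a\<^sup>2 + 2 * a * b + 2 * b\<^sup>2 + m * b + (m choose 2) + (i + 2) * a + (j + 2) * b + k * m"
  have *: "(Suc a)\<^sup>2 + 2 * Suc a * b + 2 * b\<^sup>2 + m * b + (m choose 2) + i * Suc a + j * b + k * m = (i + 1) + e"
    by (simp add: e_def algebra_simps power2_eq_square)
  show ?thesis
    using one_minus_power_neq_0[OF norm_q2, of a]
    unfolding nterm_def prod.case qfac_Suc * e_def[symmetric] power_add[of _ "(i + 1)"]
    by (simp add: divide_simps del: power_Suc)
qed

lemma nterm_Suc_b:
  "nterm q i j k (a, Suc b, m) * (1 - (q\<^sup>2) ^ Suc b) = (q\<^sup>2) ^ (j + 2) * nterm q (i + 2) (j + 4) (k + 1) (a, b, m)"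
proof -
  define e where "e = a\<^sup>2 + 2 * a * b + 2 * b\<^sup>2 + m * b + (m choose 2) + (i + 2) * a + (j + 4) * b + (k + 1) * m"
  have *: "a\<^sup>2 + 2 * a * Suc b + 2 * (Suc b)\<^sup>2 + m * Suc b + (m choose 2) + i * a + j * Suc b + k * m = (j + 2) + e"
    by (simp add: e_def algebra_simps power2_eq_square)
  show ?thesis
    using one_minus_power_neq_0[OF norm_q2, of b]
    unfolding nterm_def prod.case qfac_Suc * e_def[symmetric] power_add[of _ "(j + 2)"]
    by (simp add: divide_simps del: power_Suc)
qed

lemma nterm_Suc_m:
  "nterm q i j k (a, b, Suc m) * (1 - (q\<^sup>2) ^ Suc m) = q * (q\<^sup>2) ^ k * nterm q i (j + 1) (k + 1) (a, b, m)"
proof -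
  define e where "e = a\<^sup>2 + 2 * a * b + 2 * b\<^sup>2 + m * b + (m choose 2) + i * a + (j + 1) * b + (k + 1) * m"
  have *: "a\<^sup>2 + 2 * a * b + 2 * b\<^sup>2 + Suc m * b + (Suc m choose 2) + i * a + j * b + k * Suc m = k + e"
    by (simp add: e_def algebra_simps numeral_2_eq_2)
  show ?thesis
    using one_minus_power_neq_0[OF norm_q2, of m]
    unfolding nterm_def prod.case qfac_Suc * e_def[symmetric] power_add[of _ "k"] power_Suc[of q m]
    by (simp add: divide_simps del: power_Suc)
qed

text \<open>Raising \<open>i\<close> by 1 multiplies each term by q^(2a), so the difference inserts
  1 - q^(2a); the index a then drops by 1, and the weight with it. In \<open>nsum_diff_b\<close> the
  weight drops by 2 because b counts twice.\<close>

lemma nsum_diff_a: "nsum q i j k (Suc l) - nsum q (i + 1) j k (Suc l) = (q\<^sup>2) ^ (i + 1) * nsum q (i + 2) (j + 2) k l"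
proof -
  have "nsum q i j k (Suc l) - nsum q (i + 1) j k (Suc l)
      = (\<Sum>t\<in>triples (Suc l). nterm q i j k t * (1 - (q\<^sup>2) ^ fst t))"
    unfolding nsum_def sum_subtractf[symmetric]
    by (intro sum.cong refl) (simp add: nterm_def power_add field_simps split: prod.splits)
  also have "\<dots> = (q\<^sup>2) ^ (i + 1) * nsum q (i + 2) (j + 2) k l"
    unfolding nsum_def
  proof (rule sum_triples_eq[where h = "\<lambda>(a, b, m). (Suc a, b, m)"])
    fix t assume "t \<in> triples (Suc l)" "t \<notin> (\<lambda>(a, b, m). (Suc a, b, m)) ` triples l"
    then show "nterm q i j k t * (1 - (q\<^sup>2) ^ fst t) = 0"
      by (cases "fst t") (force simp: triples_def image_iff)+
  qed (auto simp: inj_def triples_def nterm_Suc_a[simplified] split: prod.splits)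
  finally show ?thesis .
qed

lemma nsum_diff_b: "nsum q i j k (Suc (Suc l)) - nsum q i (j + 1) k (Suc (Suc l)) = (q\<^sup>2) ^ (j + 2) * nsum q (i + 2) (j + 4) (k + 1) l"
proof -
  have "nsum q i j k (Suc (Suc l)) - nsum q i (j + 1) k (Suc (Suc l))
      = (\<Sum>t\<in>triples (Suc (Suc l)). nterm q i j k t * (1 - (q\<^sup>2) ^ fst (snd t)))"
    unfolding nsum_def sum_subtractf[symmetric]
    by (intro sum.cong refl) (simp add: nterm_def power_add field_simps split: prod.splits)
  also have "\<dots> = (q\<^sup>2) ^ (j + 2) * nsum q (i + 2) (j + 4) (k + 1) l"
    unfolding nsum_def
  proof (rule sum_triples_eq[where h = "\<lambda>(a, b, m). (a, Suc b, m)"])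
    fix t assume "t \<in> triples (Suc (Suc l))" "t \<notin> (\<lambda>(a, b, m). (a, Suc b, m)) ` triples l"
    then show "nterm q i j k t * (1 - (q\<^sup>2) ^ fst (snd t)) = 0"
      by (cases "fst (snd t)") (force simp: triples_def image_iff)+
  qed (auto simp: inj_def triples_def nterm_Suc_b[simplified] split: prod.splits)
  finally show ?thesis .
qed

lemma nsum_diff_m: "nsum q i j k (Suc l) - nsum q i j (k + 1) (Suc l) = q * (q\<^sup>2) ^ k * nsum q i (j + 1) (k + 1) l"
proof -
  have "nsum q i j k (Suc l) - nsum q i j (k + 1) (Suc l)
      = (\<Sum>t\<in>triples (Suc l). nterm q i j k t * (1 - (q\<^sup>2) ^ snd (snd t)))"
    unfolding nsum_def sum_subtractf[symmetric]
    by (intro sum.cong refl) (simp add: nterm_def power_add field_simps split: prod.splits)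
  also have "\<dots> = q * (q\<^sup>2) ^ k * nsum q i (j + 1) (k + 1) l"
    unfolding nsum_def
  proof (rule sum_triples_eq[where h = "\<lambda>(a, b, m). (a, b, Suc m)"])
    fix t assume "t \<in> triples (Suc l)" "t \<notin> (\<lambda>(a, b, m). (a, b, Suc m)) ` triples l"
    then show "nterm q i j k t * (1 - (q\<^sup>2) ^ snd (snd t)) = 0"
      by (cases "snd (snd t)") (force simp: triples_def image_iff)+
  qed (auto simp: inj_def triples_def nterm_Suc_m[simplified] split: prod.splits)
  finally show ?thesis .
qed

end

section \<open>Solving the partition recurrences by Nahm sums\<close>

lemma nsum_1_indep_b: "nsum q i j k 1 = nsum q i j' k 1"
proof -
  have "triples 1 = {(1, 0, 0), (0, 0, 1)}"
    unfolding triples_def by auto presburger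
  then show ?thesis
    by (simp add: nsum_def nterm_def)
qed

text \<open>This is the substitution of x q^2 for x, read off at the coefficient of x^l, where l = a
  + 2b + m.\<close>

lemma nsum_dilate: "(q\<^sup>2) ^ l * nsum q i j k l = nsum q (i + 1) (j + 2) (k + 1) l"
  unfolding nsum_def sum_distrib_left
proof (rule sum.cong[OF refl])
  fix t assume "t \<in> triples l"
  then obtain a b m where t: "t = (a, b, m)" "l = a + 2 * b + m"
    by (auto simp: triples_def)
  define e where "e = a\<^sup>2 + 2 * a * b + 2 * b\<^sup>2 + m * b + (m choose 2) + i * a + j * b + k * m"
  have *: "a\<^sup>2 + 2 * a * b + 2 * b\<^sup>2 + m * b + (m choose 2) + (i + 1) * a + (j + 2) * b + (k + 1) * m = l + e"
    by (simp add: e_def t algebra_simps)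
  show "(q\<^sup>2) ^ l * nterm q i j k t = nterm q (i + 1) (j + 2) (k + 1) t"
    unfolding t(1) nterm_def prod.case * e_def[symmetric] power_add[of _ l] by simp
qed

text \<open>This combination solves the two relations that the series with at most one part \<open>\<le> 2\<close> has to
  satisfy, given that \<open>nsum q 0 0 0\<close> and \<open>nsum q 1 2 1\<close> are the series for at most two and for no
  such parts.\<close>

definition nsum1 :: "complex \<Rightarrow> nat \<Rightarrow> complex" where
  "nsum1 q l = nsum q 1 1 0 l + (case l of 0 \<Rightarrow> 0 | Suc l' \<Rightarrow> q\<^sup>2 * nsum q 2 3 1 l')"

lemma nsum1_0 [simp]: "nsum1 q 0 = 1"
  by (simp add: nsum1_def)

text \<open>The parameters move from \<open>0 1 1\<close> to \<open>1 1 1\<close> by the a-relation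
  and on to \<open>1 2 1\<close> by the b-relation. The two corrections are exactly the dilated
  summands of \<open>nsum1\<close>.\<close>

lemma nsum1_dilate:
  assumes "norm q < 1"
  shows "q\<^sup>2 * (q\<^sup>2) ^ l * nsum1 q l = nsum q 0 1 1 (Suc l) - nsum q 1 2 1 (Suc l)"
proof -
  have 1: "nsum q 0 1 1 (Suc l) = nsum q 1 1 1 (Suc l) + q\<^sup>2 * nsum q 2 3 1 l"
    using nsum_diff_a[OF assms, of 0 1 1 l] by (simp add: algebra_simps eval_nat_numeral)
  have 2: "(q\<^sup>2) ^ l * nsum q 1 1 0 l = nsum q 2 3 1 l"
    using nsum_dilate[of q l 1 1 0] by (simp add: eval_nat_numeral)
  show ?thesis
  proof (cases l)
    \<comment> \<open>At weight 1 no triple has b > 0, so the shifts \<open>1 1 1\<close> and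
      \<open>1 2 1\<close> agree and the second correction is absent, as in
      \<open>nsum1 q 0\<close>.\<close>
    case 0
    then show ?thesis
      using 1 nsum_1_indep_b[of q 1 1 1 2] by simp
  next
    case (Suc l')
    have 3: "nsum q 1 1 1 (Suc l) = nsum q 1 2 1 (Suc l) + (q\<^sup>2) ^ 3 * nsum q 3 5 2 l'"
      using nsum_diff_b[OF assms, of 1 1 1 l'] Suc by (simp add: algebra_simps eval_nat_numeral)
    have 4: "(q\<^sup>2) ^ l' * nsum q 2 3 1 l' = nsum q 3 5 2 l'"
      using nsum_dilate[of q l' 2 3 1] by (simp add: eval_nat_numeral)
    have "q\<^sup>2 * (q\<^sup>2) ^ l * nsum1 q l
        = q\<^sup>2 * ((q\<^sup>2) ^ l * nsum q 1 1 0 l) + (q\<^sup>2) ^ 3 * ((q\<^sup>2) ^ l' * nsum q 2 3 1 l')"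
      using Suc by (simp add: nsum1_def algebra_simps power3_eq_cube)
    also have "\<dots> = nsum q 0 1 1 (Suc l) - nsum q 1 2 1 (Suc l)"
      unfolding 1 2 3 4 by simp
    finally show ?thesis .
  qed
qed

text \<open>The m-relation takes \<open>1 1 0\<close> to \<open>1 1 1\<close>; the a-relation then
  absorbs the second summand of \<open>nsum1\<close> and yields \<open>0 1 1\<close>.\<close>

lemma nsum1_Suc_alt:
  assumes "norm q < 1"
  shows "nsum1 q (Suc l) = nsum q 0 1 1 (Suc l) + q * nsum q 1 2 1 l"
  using nsum_diff_m[OF assms, of 1 1 0 l] nsum_diff_a[OF assms, of 0 1 1 l]
  by (simp add: nsum1_def algebra_simps eval_nat_numeral)

lemma nsum1_Suc:
  assumes "norm q < 1"
  shows "nsum1 q (Suc l) = nsum q 1 2 1 (Suc l) + (q * nsum q 1 2 1 l + q\<^sup>2 * (q\<^sup>2) ^ l * nsum1 q l)"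
  unfolding nsum1_dilate[OF assms] nsum1_Suc_alt[OF assms] by simp

lemma nsum_000_1:
  assumes "norm q < 1"
  shows "nsum q 0 0 0 (Suc 0) = nsum1 q (Suc 0)"
  using nsum_diff_a[OF assms, of 0 0 0 0] nsum_1_indep_b[of q 1 0 0 1]
  by (simp add: nsum1_def algebra_simps)

text \<open>The counterpart of \<open>psum_2_Suc_Suc\<close>: the m-relation leads from
  \<open>0 0 0\<close> to \<open>0 0 1\<close>, the b-relation on to \<open>0 1 1\<close>, and
  \<open>nsum1_dilate\<close> and \<open>nsum1_Suc_alt\<close> rewrite the \<open>0 1 1\<close>
  sums.\<close>

lemma nsum_000_Suc_Suc:
  assumes "norm q < 1"
  shows "nsum q 0 0 0 (Suc (Suc l)) = nsum1 q (Suc (Suc l))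
     + (q ^ 3 * (q\<^sup>2) ^ l * nsum1 q l + (q\<^sup>2)\<^sup>2 * (q\<^sup>2) ^ l * nsum q 1 2 1 l)"
proof -
  have 1: "nsum q 0 0 0 (Suc (Suc l)) = nsum q 0 0 1 (Suc (Suc l)) + q * nsum q 0 1 1 (Suc l)"
    using nsum_diff_m[OF assms, of 0 0 0 "Suc l"] by (simp add: algebra_simps)
  have 2: "nsum q 0 0 1 (Suc (Suc l)) = nsum q 0 1 1 (Suc (Suc l)) + (q\<^sup>2)\<^sup>2 * nsum q 2 4 2 l"
    using nsum_diff_b[OF assms, of 0 0 1 l] by (simp add: algebra_simps eval_nat_numeral)
  have 3: "(q\<^sup>2) ^ l * nsum q 1 2 1 l = nsum q 2 4 2 l"
    using nsum_dilate[of q l 1 2 1] by (simp add: eval_nat_numeral)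
  have 4: "q ^ 3 * (q\<^sup>2) ^ l * nsum1 q l = q * (q\<^sup>2 * (q\<^sup>2) ^ l * nsum1 q l)"
    by (simp add: power3_eq_cube power2_eq_square)
  have 5: "(q\<^sup>2)\<^sup>2 * (q\<^sup>2) ^ l * nsum q 1 2 1 l = (q\<^sup>2)\<^sup>2 * ((q\<^sup>2) ^ l * nsum q 1 2 1 l)"
    by (simp only: mult.assoc)
  show ?thesis
    unfolding 4 5 3 1 2 nsum1_dilate[OF assms] nsum1_Suc_alt[OF assms] by (simp add: algebra_simps)
qed

section \<open>Euler's product expansion\<close>

lemma convergent_prod_qpoch: "norm q < 1 \<Longrightarrow> convergent_prod (\<lambda>i. 1 - a * q ^ i :: complex)"
  by (intro abs_convergent_prod_imp_convergent_prod summable_imp_abs_convergent_prod)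
     (simp add: norm_mult norm_power summable_geometric)

text \<open>The first n factors split off the infinite product. The tail must be shown nonzero
  because \<open>qpoch\<close> divides by it.\<close>

lemma qpoch_qq:
  assumes "norm q < 1"
  shows "qpoch q q n = qfac q n"
proof -
  have nz: "qpoch_inf (q * q ^ n) q \<noteq> 0"
    unfolding qpoch_inf_def
  proof (intro prodinf_nonzero convergent_prod_qpoch assms)
    fix i show "1 - q * q ^ n * q ^ i \<noteq> 0"
      using one_minus_power_neq_0[OF assms, of "n + i"] by (simp add: power_add mult_ac)
  qed
  have "qpoch_inf q q = (\<Prod>i. 1 - q * q ^ (i + n)) * (\<Prod>i<n. 1 - q * q ^ i)"
    unfolding qpoch_inf_def
  proof (intro prodinf_split_initial_segment convergent_prod_qpoch assms)
    fix i show "1 - q * q ^ i \<noteq> 0"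
      using one_minus_power_neq_0[OF assms, of i] by simp
  qed
  then have "qpoch_inf q q = qpoch_inf (q * q ^ n) q * qfac q n"
    by (simp add: qpoch_inf_def qfac_def power_add mult_ac)
  with nz show ?thesis
    by (simp add: qpoch_def)
qed

text \<open>The ratio of consecutive terms is y r^n, which tends to 0 for every y. This leaves room
  for the geometric bound on 1 / (q;q)_n below.\<close>

lemma summable_power_choose_2:
  fixes y r :: real
  assumes "0 \<le> r" "r < 1" "0 \<le> y"
  shows "summable (\<lambda>n. y ^ n * r ^ (n choose 2))"
proof -
  have "(\<lambda>n. y * r ^ n) \<longlonglongrightarrow> y * 0"
    using assms by (intro tendsto_intros LIMSEQ_power_zero) auto
  then have "eventually (\<lambda>n. y * r ^ n < 1 / 2) sequentially"
    by (rule order_tendstoD) simp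
  then obtain N where N: "\<And>n. N \<le> n \<Longrightarrow> y * r ^ n < 1 / 2"
    by (auto simp: eventually_sequentially)
  show ?thesis
  proof (rule summable_ratio_test[of "1 / 2" N])
    fix n assume "N \<le> n"
    have "y ^ Suc n * r ^ (Suc n choose 2) = (y * r ^ n) * (y ^ n * r ^ (n choose 2))"
      by (simp add: numeral_2_eq_2 power_add)
    also have "\<dots> \<le> 1 / 2 * (y ^ n * r ^ (n choose 2))"
      using N[OF \<open>N \<le> n\<close>] assms by (intro mult_right_mono) auto
    finally show "norm (y ^ Suc n * r ^ (Suc n choose 2)) \<le> 1 / 2 * norm (y ^ n * r ^ (n choose 2))"
      using assms by simp
  qed simp
qed

lemma norm_inverse_qfac_le:
  assumes "norm q < 1"
  shows "norm (1 / qfac q n) \<le> (1 / (1 - norm q)) ^ n"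
proof (induction n)
  case (Suc n)
  have "norm (q ^ Suc n) \<le> norm q"
    using assms power_Suc_le_self[of "norm q" n] by (simp add: norm_power del: power_Suc)
  then have "1 - norm q \<le> norm (1 - q ^ Suc n)"
    using norm_triangle_ineq2[of 1 "q ^ Suc n"] by (simp del: power_Suc)
  then have "norm (1 / (1 - q ^ Suc n)) \<le> 1 / (1 - norm q)"
    using assms by (simp add: norm_divide frac_le del: power_Suc)
  then have "norm (1 / qfac q n) * norm (1 / (1 - q ^ Suc n)) \<le> (1 / (1 - norm q)) ^ n * (1 / (1 - norm q))"
    using Suc assms by (intro mult_mono) auto
  then show ?case
    by (simp add: norm_mult norm_divide)
qed simp

lemma summable_euler:
  assumes "norm q < 1"
  shows "summable (\<lambda>m. norm (q ^ (m choose 2) / qfac q m * z ^ m))"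
proof (rule summable_comparison_test')
  show "summable (\<lambda>m. (norm z * (1 / (1 - norm q))) ^ m * norm q ^ (m choose 2))"
    using assms by (intro summable_power_choose_2) auto
  fix m
  have "norm (q ^ (m choose 2) / qfac q m * z ^ m) = norm z ^ m * norm (1 / qfac q m) * norm q ^ (m choose 2)"
    by (simp add: norm_mult norm_divide norm_power)
  also have "\<dots> \<le> norm z ^ m * (1 / (1 - norm q)) ^ m * norm q ^ (m choose 2)"
    using norm_inverse_qfac_le[OF assms] assms by (intro mult_mono mult_nonneg_nonneg zero_le_power) auto
  finally show "norm (norm (q ^ (m choose 2) / qfac q m * z ^ m)) \<le> (norm z * (1 / (1 - norm q))) ^ m * norm q ^ (m choose 2)"
    by (simp only: power_mult_distrib real_norm_def abs_norm_cancel)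
qed

text \<open>The power series f satisfies f(z) = (1 + z) f(zq); iterating this produces the partial
  products of the infinite product.\<close>

lemma qpoch_inf_euler:
  assumes "norm q < 1"
  shows "(\<lambda>m. q ^ (m choose 2) / qfac q m * z ^ m) sums qpoch_inf (- z) q"
proof -
  define c where "c m = q ^ (m choose 2) / qfac q m" for m
  define f where "f z = (\<Sum>m. c m * z ^ m)" for z
  have summ: "summable (\<lambda>m. c m * z ^ m)" for z
    unfolding c_def by (rule summable_norm_cancel[OF summable_euler[OF assms]])
  have step: "f z = (1 + z) * f (z * q)" for z
  proof -
    have "f z - f (z * q) = (\<Sum>m. c m * z ^ m - c m * (z * q) ^ m)"
      unfolding f_def by (intro suminf_diff summ)
    also have "\<dots> = (\<Sum>m. c (Suc m) * z ^ Suc m - c (Suc m) * (z * q) ^ Suc m)"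
      using suminf_split_head[OF summable_diff[OF summ[of z] summ[of "z * q"]]] by simp
    also have "\<dots> = (\<Sum>m. z * (c m * (z * q) ^ m))"
    proof (rule arg_cong[where f = suminf], rule ext)
      fix m
      have "c (Suc m) * (1 - q ^ Suc m) = c m * q ^ m"
        using one_minus_power_neq_0[OF assms, of m] 
        by (simp add: c_def numeral_2_eq_2 power_add del: power_Suc)
      then have "c (Suc m) * (1 - q ^ Suc m) * z ^ Suc m = z * (c m * (z * q) ^ m)"
        by (simp add: power_mult_distrib)
      then show "c (Suc m) * z ^ Suc m - c (Suc m) * (z * q) ^ Suc m = z * (c m * (z * q) ^ m)"
        by (simp add: power_mult_distrib algebra_simps)
    qed
    also have "\<dots> = z * f (z * q)"
      unfolding f_def by (intro suminf_mult summ)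
    finally show ?thesis by (simp add: algebra_simps)
  qed
  have prod: "f z = (\<Prod>i\<le>n. 1 - (- z) * q ^ i) * f (z * q ^ Suc n)" for n
  proof (induction n)
    case 0
    then show ?case using step[of z] by simp
  next
    case (Suc n)
    then show ?case using step[of "z * q ^ Suc n"] by (simp add: mult_ac)
  qed
  \<comment> \<open>The factor left over after n + 1 iterations is f(z q^(n+1)), which tends to f(0)
    = 1 by continuity.\<close>
  have "isCont f 0"
    unfolding f_def by (rule isCont_powser_converges_everywhere[OF summ])
  moreover have "(\<lambda>n. z * q ^ Suc n) \<longlonglongrightarrow> z * 0"
    using assms by (intro tendsto_intros LIMSEQ_Suc[OF LIMSEQ_power_zero]) 
  ultimately have "(\<lambda>n. f (z * q ^ Suc n)) \<longlonglongrightarrow> f 0"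
    by (intro isCont_tendsto_compose[of 0 f]) auto
  moreover have "f 0 = 1"
    unfolding f_def powser_zero by (simp add: c_def binomial_eq_0)
  moreover have "(\<lambda>n. \<Prod>i\<le>n. 1 - (- z) * q ^ i) \<longlonglongrightarrow> qpoch_inf (- z) q"
    unfolding qpoch_inf_def by (rule convergent_prod_LIMSEQ[OF convergent_prod_qpoch[OF assms]])
  ultimately have "(\<lambda>n. (\<Prod>i\<le>n. 1 - (- z) * q ^ i) * f (z * q ^ Suc n)) \<longlonglongrightarrow> qpoch_inf (- z) q * 1"
    by (intro tendsto_mult) auto
  then have "(\<lambda>n. f z) \<longlonglongrightarrow> qpoch_inf (- z) q"
    unfolding prod[symmetric] by simp
  then have "f z = qpoch_inf (- z) q"
    by (simp add: LIMSEQ_const_iff)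
  then show ?thesis
    using summable_sums[OF summ, of z] by (simp add: f_def c_def)
qed

section \<open>The partition generating function\<close>

lemma abs_summable_on_Times:
  fixes f :: "'a \<Rightarrow> 'c :: {real_normed_div_algebra, banach}"
  assumes "(\<lambda>a. norm (f a)) summable_on A" "(\<lambda>b. norm (g b)) summable_on A'"
  shows "(\<lambda>(a, b). norm (f a * g b)) summable_on A \<times> A'"
proof -
  have "(\<lambda>t. norm (case t of (a, b) \<Rightarrow> f a * g b)) summable_on A \<times> A'"
    unfolding Infinite_Sum.abs_summable_on_Sigma_iff
  proof (intro conjI ballI)
    show "(\<lambda>b. norm (case (a, b) of (a, b) \<Rightarrow> f a * g b)) summable_on A'" for a
      using summable_on_cmult_right[OF assms(2), of "norm (f a)"] by (simp add: norm_mult)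
    have "(\<lambda>a. norm (f a) * infsum (\<lambda>b. norm (g b)) A') summable_on A"
      by (rule summable_on_cmult_left[OF assms(1)])
    then show "(\<lambda>a. norm (\<Sum>\<^sub>\<infinity>b\<in>A'. norm (case (a, b) of (a, b) \<Rightarrow> f a * g b))) summable_on A"
      by (simp add: norm_mult infsum_cmult_right' infsum_nonneg)
  qed
  then show ?thesis
    by (simp add: case_prod_unfold)
qed

text \<open>The sum over all lists of length l is the l-fold product of a geometric series; every
  sum over \<open>parts k l\<close> is a subsum of it.\<close>

lemma abs_summable_on_lists:
  fixes q :: complex
  assumes "norm q < 1"
  shows "(\<lambda>ys. norm (q ^ sum_list ys)) summable_on {ys. length ys = l}"
proof (induction l)
  case (Suc l)
  have "(\<lambda>n. norm (q ^ n)) summable_on UNIV"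
    using assms by (intro norm_summable_imp_summable_on) (simp add: norm_power summable_geometric)
  from abs_summable_on_Times[OF this Suc]
  have "(\<lambda>ys. norm (q ^ sum_list ys)) \<circ> (\<lambda>(a, ys). a # ys) summable_on (UNIV \<times> {ys. length ys = l})"
    by (simp add: o_def case_prod_unfold power_add)
  then have "(\<lambda>ys. norm (q ^ sum_list ys)) summable_on (\<lambda>(a, ys). a # ys) ` (UNIV \<times> {ys. length ys = l})"
    by (subst summable_on_reindex) (auto simp: inj_on_def)
  also have "(\<lambda>(a, ys). a # ys) ` (UNIV \<times> {ys :: nat list. length ys = l}) = {ys. length ys = Suc l}"
    by (force simp: length_Suc_conv image_iff)
  finally show ?case .
qed simp

text \<open>The coefficient of x^l in G_k(x), evaluated at the complex number q.\<close>

definition psum :: "complex \<Rightarrow> nat \<Rightarrow> nat \<Rightarrow> complex" where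
  "psum q k l = (\<Sum>\<^sub>\<infinity>ys\<in>parts k l. q ^ sum_list ys)"

lemma length_parts: "ys \<in> parts k l \<Longrightarrow> length ys = l"
  by (simp add: parts_def)

lemma psum_0 [simp]: "psum q k 0 = 1"
  by (simp add: psum_def parts_k_0)

lemma sum_list_shift: "sum_list (map (\<lambda>y. y + 2) ys) = 2 * length ys + sum_list (ys :: nat list)"
  by (induction ys) auto

lemma infsum_image_parts:
  assumes "inj_on h (parts k l)" "\<And>ys. ys \<in> parts k l \<Longrightarrow> sum_list (h ys) = c + sum_list ys"
  shows "(\<Sum>\<^sub>\<infinity>ys\<in>h ` parts k l. q ^ sum_list ys) = q ^ c * psum q k l"
proof -
  have "(\<Sum>\<^sub>\<infinity>ys\<in>h ` parts k l. q ^ sum_list ys) = (\<Sum>\<^sub>\<infinity>ys\<in>parts k l. q ^ c * q ^ sum_list ys)"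
    unfolding infsum_reindex[OF assms(1)] o_def
    by (rule infsum_cong) (simp only: assms(2) power_add)
  then show ?thesis
    by (simp only: psum_def infsum_cmult_right')
qed

lemma psum_dilate: "psum q 0 l = (q\<^sup>2) ^ l * psum q 2 l"
proof -
  have "psum q 0 l = q ^ (2 * l) * psum q 2 l"
    unfolding psum_def[of q 0] parts_0
    by (rule infsum_image_parts) (auto simp: sum_list_shift[simplified] parts_def inj_on_def)
  then show ?thesis by (simp add: power_mult)
qed

section \<open>Recurrences for the partition series and their unique solution\<close>

context
  fixes q :: complex
  assumes q: "norm q < 1"
begin

lemma summable_on_lists:
  "A \<subseteq> {ys. length ys = l} \<Longrightarrow> (\<lambda>ys. q ^ sum_list ys) summable_on A"
  by (rule summable_on_subset_banach[OF abs_summable_summable[OF abs_summable_on_lists[OF q]]])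

lemma infsum_lists_Un:
  assumes "A \<subseteq> {ys. length ys = l}" "A' \<subseteq> {ys. length ys = l}" "A'' \<subseteq> {ys. length ys = l}"
    "A \<inter> A' = {}" "A \<inter> A'' = {}" "A' \<inter> A'' = {}"
  shows "(\<Sum>\<^sub>\<infinity>ys\<in>A \<union> (A' \<union> A''). q ^ sum_list ys)
     = (\<Sum>\<^sub>\<infinity>ys\<in>A. q ^ sum_list ys) + ((\<Sum>\<^sub>\<infinity>ys\<in>A'. q ^ sum_list ys) + (\<Sum>\<^sub>\<infinity>ys\<in>A''. q ^ sum_list ys))"
proof -
  note summ = summable_on_lists[of _ l]
  have "(\<Sum>\<^sub>\<infinity>ys\<in>A' \<union> A''. q ^ sum_list ys) = (\<Sum>\<^sub>\<infinity>ys\<in>A'. q ^ sum_list ys) + (\<Sum>\<^sub>\<infinity>ys\<in>A''. q ^ sum_list ys)"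
    using assms by (intro infsum_Un_disjoint summ) auto
  moreover have "(\<Sum>\<^sub>\<infinity>ys\<in>A \<union> (A' \<union> A''). q ^ sum_list ys)
      = (\<Sum>\<^sub>\<infinity>ys\<in>A. q ^ sum_list ys) + (\<Sum>\<^sub>\<infinity>ys\<in>A' \<union> A''. q ^ sum_list ys)"
    using assms by (intro infsum_Un_disjoint summ) auto
  ultimately show ?thesis by simp
qed

lemma psum_1_Suc:
  "psum q 1 (Suc l) = psum q 0 (Suc l) + (q * psum q 0 l + q\<^sup>2 * (q\<^sup>2) ^ l * psum q 1 l)"
proof -
  have "(\<Sum>\<^sub>\<infinity>ys\<in>Cons 1 ` parts 0 l. q ^ sum_list ys) = q ^ 1 * psum q 0 l"
    by (rule infsum_image_parts) auto
  moreover have "(\<Sum>\<^sub>\<infinity>ys\<in>(\<lambda>ys. 2 # map (\<lambda>y. y + 2) ys) ` parts 1 l. q ^ sum_list ys)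
      = q ^ (2 + 2 * l) * psum q 1 l"
    by (rule infsum_image_parts) (auto simp: sum_list_shift[simplified] parts_def inj_on_def)
  moreover have "psum q 1 (Suc l) = psum q 0 (Suc l) + ((\<Sum>\<^sub>\<infinity>ys\<in>Cons 1 ` parts 0 l. q ^ sum_list ys)
      + (\<Sum>\<^sub>\<infinity>ys\<in>(\<lambda>ys. 2 # map (\<lambda>y. y + 2) ys) ` parts 1 l. q ^ sum_list ys))"
    unfolding psum_def parts_1_Suc
  proof (rule infsum_lists_Un[of _ "Suc l"])
    show "parts 0 (Suc l) \<inter> Cons 1 ` parts 0 l = {}"
      "parts 0 (Suc l) \<inter> (\<lambda>ys. 2 # map (\<lambda>y. y + 2) ys) ` parts 1 l = {}"
      by (auto simp: parts_0_iff)
  qed (auto dest: length_parts)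
  ultimately show ?thesis
    by (simp add: power_add power_mult power2_eq_square)
qed

lemma psum_2_1: "psum q 2 (Suc 0) = psum q 1 (Suc 0)"
  by (simp add: psum_def parts_2_1)

lemma psum_2_Suc_Suc:
  "psum q 2 (Suc (Suc l)) = psum q 1 (Suc (Suc l))
     + (q ^ 3 * (q\<^sup>2) ^ l * psum q 1 l + (q\<^sup>2)\<^sup>2 * (q\<^sup>2) ^ l * psum q 0 l)"
proof -
  have "(\<Sum>\<^sub>\<infinity>ys\<in>(\<lambda>ys. 1 # 2 # map (\<lambda>y. y + 2) ys) ` parts 1 l. q ^ sum_list ys)
      = q ^ (3 + 2 * l) * psum q 1 l"
    by (rule infsum_image_parts) (auto simp: sum_list_shift[simplified] parts_def inj_on_def)
  moreover have "(\<Sum>\<^sub>\<infinity>ys\<in>(\<lambda>ys. 2 # 2 # map (\<lambda>y. y + 2) ys) ` parts 0 l. q ^ sum_list ys)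
      = q ^ (4 + 2 * l) * psum q 0 l"
    by (rule infsum_image_parts) (auto simp: sum_list_shift[simplified] parts_def inj_on_def)
  moreover have "psum q 2 (Suc (Suc l)) = psum q 1 (Suc (Suc l))
      + ((\<Sum>\<^sub>\<infinity>ys\<in>(\<lambda>ys. 1 # 2 # map (\<lambda>y. y + 2) ys) ` parts 1 l. q ^ sum_list ys)
      + (\<Sum>\<^sub>\<infinity>ys\<in>(\<lambda>ys. 2 # 2 # map (\<lambda>y. y + 2) ys) ` parts 0 l. q ^ sum_list ys))"
    unfolding psum_def parts_2_Suc_Suc
  proof (rule infsum_lists_Un[of _ "Suc (Suc l)"])
    have "1 # 2 # ys \<notin> parts 1 (Suc (Suc l))" "2 # 2 # ys \<notin> parts 1 (Suc (Suc l))" for ys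
      by (simp_all add: parts_def)
    then show "parts 1 (Suc (Suc l)) \<inter> (\<lambda>ys. 1 # 2 # map (\<lambda>y. y + 2) ys) ` parts 1 l = {}"
      "parts 1 (Suc (Suc l)) \<inter> (\<lambda>ys. 2 # 2 # map (\<lambda>y. y + 2) ys) ` parts 0 l = {}"
      by blast+
  qed (auto dest: length_parts)
  moreover have "q ^ (4 + 2 * l) = (q\<^sup>2)\<^sup>2 * (q\<^sup>2) ^ l"
    by (simp add: power_add flip: power_mult)
  ultimately show ?thesis
    by (simp add: power_add power_mult)
qed

lemma psum_eq_nsum:
  "psum q 2 l = nsum q 0 0 0 l \<and> psum q 1 l = nsum1 q l \<and> psum q 0 l = nsum q 1 2 1 l"
proof (induction l rule: less_induct)
  case (less l)
  \<comment> \<open>At weight l the terms \<open>a\<close> and \<open>b\<close> come from smaller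
    weights, so the difference of outer unknowns \<open>u2 - u0 = a + b\<close> is known. Together
    with \<open>u0 = c * u2\<close>, where c = q^(2l) is not 1 for l > 0, it fixes all three
    values.\<close>
  have unique: "u2 = v2 \<and> u1 = v1 \<and> u0 = v0"
    if "u2 = u1 + a" "u1 = u0 + b" "u0 = c * u2" "v2 = v1 + a" "v1 = v0 + b" "v0 = c * v2" "c \<noteq> 1"
    for u0 u1 u2 v0 v1 v2 a b c :: complex
  proof -
    have "u2 - u0 = v2 - v0"
      unfolding that(1,2,4,5) by simp
    then have "(1 - c) * u2 = (1 - c) * v2"
      unfolding that(3,6) by (simp only: left_diff_distrib mult_1)
    then have "u2 = v2"
      using that(7) by simp
    then show ?thesis
      using that(1,2,4,5) by simp
  qed
  have dilate: "nsum q 1 2 1 l = (q\<^sup>2) ^ l * nsum q 0 0 0 l"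
    using nsum_dilate[of q l 0 0 0] by (simp add: eval_nat_numeral)
  have ne: "(q\<^sup>2) ^ l \<noteq> 1" if "l \<noteq> 0"
    using one_minus_power_neq_0[OF norm_q2[OF q], of "l - 1"] that by (simp del: power_Suc)
  consider "l = 0" | "l = Suc 0" | l' where "l = Suc (Suc l')"
    by (cases l; cases "l - 1") auto
  then show ?case
  proof cases
    case 2
    show ?thesis
    proof (rule unique)
      show "psum q 2 l = psum q 1 l + 0" "nsum q 0 0 0 l = nsum1 q l + 0"
        using psum_2_1 nsum_000_1[OF q] 2 by simp_all
      \<comment> \<open>All series equal 1 at weight 0, so the correction at weight 1 is the
        contribution q + q^2 of the one-part lists 1 and 2.\<close>
      show "psum q 1 l = psum q 0 l + (q + q\<^sup>2)" "nsum1 q l = nsum q 1 2 1 l + (q + q\<^sup>2)"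
        using psum_1_Suc[of 0] nsum1_Suc[OF q, of 0] 2 by simp_all
    qed (rule psum_dilate dilate ne; simp add: 2)+
  next
    case 3
    then have IH: "psum q 1 (Suc l') = nsum1 q (Suc l')" "psum q 0 (Suc l') = nsum q 1 2 1 (Suc l')"
        "psum q 1 l' = nsum1 q l'" "psum q 0 l' = nsum q 1 2 1 l'"
      using less[of "Suc l'"] less[of l'] by auto
    show ?thesis
      by (rule unique[OF psum_2_Suc_Suc[of l', folded 3] psum_1_Suc[of "Suc l'", folded 3] psum_dilate
            nsum_000_Suc_Suc[OF q, of l', folded 3 IH] nsum1_Suc[OF q, of "Suc l'", folded 3 IH] dilate ne])
         (simp add: 3)
  qed simp
qed

end

section \<open>Rearranging the triple series\<close>

definition xterm :: "complex \<Rightarrow> complex \<Rightarrow> nat \<times> nat \<times> nat \<Rightarrow> complex" where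
  "xterm x q = (\<lambda>(a, b, m). x ^ (a + 2 * b + m) * nterm q 0 0 0 (a, b, m))"

lemma choose_2_le_square: "n choose 2 \<le> n\<^sup>2"
proof -
  have "n * (n - 1) div 2 \<le> n * (n - 1)"
    by (rule div_le_dividend)
  also have "\<dots> \<le> n\<^sup>2"
    by (simp add: power2_eq_square)
  finally show ?thesis by (simp add: choose_two)
qed

text \<open>The terms are dominated by a product of three one-variable series \<open>u\<close>; b
  has weight 2 and therefore comes with |x|^2.\<close>

lemma summable_xterm:
  assumes "norm q < 1"
  shows "(\<lambda>t. norm (xterm x q t)) summable_on UNIV"
proof -
  define r where "r = norm (q\<^sup>2)"
  define K where "K = 1 / (1 - r)"
  define u where "u y n = (y * K) ^ n * r ^ (n choose 2)" for y n
  have r: "0 \<le> r" "r < 1"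
    using norm_q2[OF assms] by (auto simp: r_def)
  then have K: "0 \<le> K" by (simp add: K_def)
  have u: "(\<lambda>n. norm (u y n)) summable_on UNIV" if "0 \<le> y" for y
    unfolding u_def
    by (rule norm_summable_imp_summable_on) (use r K that summable_power_choose_2 in simp)
  have le: "norm (xterm x q (a, b, m)) \<le> u (norm x) a * (u (norm x ^ 2) b * u (norm x) m)" for a b m
  proof -
    have "norm (xterm x q (a, b, m)) = norm x ^ (a + 2 * b + m) * (norm q ^ m *
        r ^ (a\<^sup>2 + 2 * a * b + 2 * b\<^sup>2 + m * b + (m choose 2))
        * (norm (1 / qfac (q\<^sup>2) a) * norm (1 / qfac (q\<^sup>2) b) * norm (1 / qfac (q\<^sup>2) m)))"
      by (simp add: xterm_def nterm_def norm_mult norm_divide norm_power r_def)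
    \<comment> \<open>Dropping the mixed terms and replacing squares by binomials lowers the
      exponent of r < 1 and makes the bound factor.\<close>
    also have "\<dots> \<le> norm x ^ (a + 2 * b + m) * (1 * r ^ ((a choose 2) + (b choose 2) + (m choose 2))
        * (K ^ a * K ^ b * K ^ m))"
    proof (intro mult_left_mono mult_mono)
      show "norm q ^ m \<le> 1"
        using assms by (simp add: power_le_one)
      have "(a choose 2) + (b choose 2) + (m choose 2) \<le> a\<^sup>2 + 2 * a * b + 2 * b\<^sup>2 + m * b + (m choose 2)"
        using choose_2_le_square[of a] choose_2_le_square[of b] by simp
      then show "r ^ (a\<^sup>2 + 2 * a * b + 2 * b\<^sup>2 + m * b + (m choose 2)) \<le> r ^ ((a choose 2) + (b choose 2) + (m choose 2))"
        using r by (intro power_decreasing) auto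
    qed (use norm_inverse_qfac_le[OF norm_q2[OF assms]] r K in \<open>auto simp: K_def r_def\<close>)
    also have "\<dots> = u (norm x) a * (u (norm x ^ 2) b * u (norm x) m)"
      by (simp add: u_def power_add power_mult_distrib mult_ac flip: power_mult)
    finally show ?thesis .
  qed
  have "(\<lambda>(b, m). norm (u (norm x ^ 2) b * u (norm x) m)) summable_on UNIV \<times> UNIV"
    by (rule abs_summable_on_Times[OF u u]) auto
  then have "(\<lambda>t. norm (case t of (b, m) \<Rightarrow> u (norm x ^ 2) b * u (norm x) m)) summable_on UNIV"
    by (simp add: case_prod_unfold)
  from abs_summable_on_Times[OF u[of "norm x"] this]
  have "(\<lambda>(a, b, m). norm (u (norm x) a * (u (norm x ^ 2) b * u (norm x) m))) summable_on UNIV"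
    by (simp add: case_prod_unfold)
  moreover have "norm (u (norm x) a * (u (norm x ^ 2) b * u (norm x) m)) = u (norm x) a * (u (norm x ^ 2) b * u (norm x) m)" for a b m
    using r K by (simp add: u_def)
  ultimately have "(\<lambda>(a, b, m). u (norm x) a * (u (norm x ^ 2) b * u (norm x) m)) summable_on UNIV"
    by simp
  then show ?thesis
    by (rule Infinite_Sum.abs_summable_on_comparison_test') (use le in auto)
qed

lemma bij_triples: "bij_betw snd (Sigma UNIV triples) UNIV"
  by (rule bij_betwI[where g = "\<lambda>t. (fst t + 2 * fst (snd t) + snd (snd t), t)"]) (auto simp: triples_def)

lemma xterm_eq: "t \<in> triples l \<Longrightarrow> xterm x q t = x ^ l * nterm q 0 0 0 t"
  by (auto simp: xterm_def triples_def)

lemma has_sum_by_weight: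
  assumes "norm q < 1"
  shows "((\<lambda>l. x ^ l * nsum q 0 0 0 l) has_sum infsum (xterm x q) UNIV) UNIV"
proof (rule has_sum_Sigma')
  have "(xterm x q has_sum infsum (xterm x q) UNIV) UNIV"
    using abs_summable_summable[OF summable_xterm[OF assms]] by (rule has_sum_infsum)
  then show "((\<lambda>t. xterm x q (snd t)) has_sum infsum (xterm x q) UNIV) (Sigma UNIV triples)"
    by (subst has_sum_reindex_bij_betw[OF bij_triples])
next
  fix l
  show "((\<lambda>t. xterm x q (snd (l, t))) has_sum x ^ l * nsum q 0 0 0 l) (triples l)"
    by (rule has_sum_finiteI) (auto simp: finite_triples nsum_def sum_distrib_left xterm_eq intro!: sum.cong)
qed

lemma abs_summable_by_weight:
  assumes "norm q < 1"
  shows "(\<lambda>l. norm (x ^ l * nsum q 0 0 0 l)) summable_on UNIV"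
proof (rule Infinite_Sum.abs_summable_on_comparison_test')
  have "(\<lambda>t. norm (xterm x q (snd t))) summable_on (Sigma UNIV triples)"
    by (subst summable_on_reindex_bij_betw[OF bij_triples, of "\<lambda>t. norm (xterm x q t)"])
       (rule summable_xterm[OF assms])
  then have "(\<lambda>(l, t). norm (xterm x q t)) summable_on (Sigma UNIV triples)"
    by (simp add: case_prod_unfold)
  then show "(\<lambda>l. \<Sum>\<^sub>\<infinity>t\<in>triples l. norm (xterm x q t)) summable_on UNIV"
    by (rule summable_on_Sigma_banach)
  fix l
  have "x ^ l * nsum q 0 0 0 l = (\<Sum>t\<in>triples l. xterm x q t)"
    by (auto simp: nsum_def sum_distrib_left xterm_eq intro!: sum.cong)
  then show "norm (x ^ l * nsum q 0 0 0 l) \<le> (\<Sum>\<^sub>\<infinity>t\<in>triples l. norm (xterm x q t))"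
    by (simp add: finite_triples norm_sum)
qed

text \<open>The substitution a = N1 - N2, b = N2 makes (N1, N2) range over all pairs (a, b); for a
  fixed pair, summation over m is Euler's expansion in base q^2 at z = x q^(1+2b).\<close>

lemma has_sum_multisum:
  assumes "norm q < 1"
  shows "((\<lambda>(N1, N2). q ^ (2 * (N1\<^sup>2 + N2\<^sup>2)) * qpoch_inf (- x * q ^ (1 + 2 * N2)) (q\<^sup>2)
                  * x ^ (N1 + N2) / (qpoch (q\<^sup>2) (q\<^sup>2) (N1 - N2) * qpoch (q\<^sup>2) (q\<^sup>2) N2))
              has_sum infsum (xterm x q) UNIV) {(N1, N2). N2 \<le> N1}"
proof (rule has_sum_Sigma')
  let ?h = "\<lambda>t. (fst (fst t) - snd (fst t), snd (fst t), snd t)"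
  have bij: "bij_betw ?h ({(N1, N2). N2 \<le> N1} \<times> UNIV) (UNIV :: (nat \<times> nat \<times> nat) set)"
    by (rule bij_betwI[where g = "\<lambda>(a, b, m). ((a + b, b), m)"]) auto
  have "(xterm x q has_sum infsum (xterm x q) UNIV) UNIV"
    using abs_summable_summable[OF summable_xterm[OF assms]] by (rule has_sum_infsum)
  then show "((\<lambda>t. xterm x q (?h t)) has_sum infsum (xterm x q) UNIV) ({(N1, N2). N2 \<le> N1} \<times> UNIV)"
    by (subst has_sum_reindex_bij_betw[OF bij])
next
  fix N :: "nat \<times> nat" assume "N \<in> {(N1, N2). N2 \<le> N1}"
  then obtain a b where N: "N = (a + b, b)"
    by (auto simp: le_iff_add add.commute)
  define z where "z = x * q ^ (1 + 2 * b)"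
  define c where "c = q ^ (2 * ((a + b)\<^sup>2 + b\<^sup>2)) * x ^ (a + b + b) / (qfac (q\<^sup>2) a * qfac (q\<^sup>2) b)"
  have "((\<lambda>m. (q\<^sup>2) ^ (m choose 2) / qfac (q\<^sup>2) m * z ^ m) has_sum qpoch_inf (- z) (q\<^sup>2)) UNIV"
    using norm_q2[OF assms] by (intro norm_summable_imp_has_sum summable_euler qpoch_inf_euler)
  then have "((\<lambda>m. c * ((q\<^sup>2) ^ (m choose 2) / qfac (q\<^sup>2) m * z ^ m)) has_sum c * qpoch_inf (- z) (q\<^sup>2)) UNIV"
    by (rule has_sum_cmult_right)
  moreover have "c * ((q\<^sup>2) ^ (m choose 2) / qfac (q\<^sup>2) m * z ^ m) = xterm x q (a, b, m)" for m
  proof -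
    have "q ^ (2 * ((a + b)\<^sup>2 + b\<^sup>2)) * ((q\<^sup>2) ^ (m choose 2) * (q ^ (1 + 2 * b)) ^ m)
       = q ^ (2 * ((a + b)\<^sup>2 + b\<^sup>2) + (2 * (m choose 2) + (1 + 2 * b) * m))"
      by (simp only: power_add power_mult)
    also have "2 * ((a + b)\<^sup>2 + b\<^sup>2) + (2 * (m choose 2) + (1 + 2 * b) * m)
        = m + 2 * (a\<^sup>2 + 2 * a * b + 2 * b\<^sup>2 + m * b + (m choose 2) + 0 * a + 0 * b + 0 * m)"
      by (simp add: power2_eq_square algebra_simps)
    also have "q ^ \<dots> = q ^ m * (q\<^sup>2) ^ (a\<^sup>2 + 2 * a * b + 2 * b\<^sup>2 + m * b + (m choose 2) + 0 * a + 0 * b + 0 * m)"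
      by (simp only: power_add power_mult)
    finally have *: "q ^ m * (q\<^sup>2) ^ (a\<^sup>2 + 2 * a * b + 2 * b\<^sup>2 + m * b + (m choose 2) + 0 * a + 0 * b + 0 * m)
        = q ^ (2 * ((a + b)\<^sup>2 + b\<^sup>2)) * ((q\<^sup>2) ^ (m choose 2) * (q ^ (1 + 2 * b)) ^ m)" ..
    have **: "x ^ (a + 2 * b + m) = x ^ (a + b + b) * x ^ m"
      by (simp only: mult_2 add.assoc flip: power_add)
    show ?thesis
      unfolding xterm_def nterm_def prod.case * ** c_def z_def power_mult_distrib[of x] by simp
  qed
  moreover have "(case N of (N1, N2) \<Rightarrow> q ^ (2 * (N1\<^sup>2 + N2\<^sup>2)) * qpoch_inf (- x * q ^ (1 + 2 * N2)) (q\<^sup>2)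
                  * x ^ (N1 + N2) / (qpoch (q\<^sup>2) (q\<^sup>2) (N1 - N2) * qpoch (q\<^sup>2) (q\<^sup>2) N2))
      = c * qpoch_inf (- z) (q\<^sup>2)"
    by (simp add: N c_def z_def qpoch_qq[OF norm_q2[OF assms]])
  ultimately show "((\<lambda>m. xterm x q (fst (fst (N, m)) - snd (fst (N, m)), snd (fst (N, m)), snd (N, m))) has_sum
     (case N of (N1, N2) \<Rightarrow> q ^ (2 * (N1\<^sup>2 + N2\<^sup>2)) * qpoch_inf (- x * q ^ (1 + 2 * N2)) (q\<^sup>2)
                  * x ^ (N1 + N2) / (qpoch (q\<^sup>2) (q\<^sup>2) (N1 - N2) * qpoch (q\<^sup>2) (q\<^sup>2) N2))) UNIV"
    by (simp add: N)
qed

lemma has_sum_parts: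
  assumes "norm q < 1"
  shows "((\<lambda>(l, ys). x ^ l * q ^ sum_list ys) has_sum infsum (xterm x q) UNIV) (Sigma UNIV (parts 2))"
proof -
  \<comment> \<open>Absolute summability is obtained from the identity itself at |x| and |q|: the
    inner sums of norms are \<open>psum q' 2 l\<close> up to |x|^l, hence equal to
    \<open>nsum q' 0 0 0 l\<close>, and the outer sum converges by
    \<open>abs_summable_by_weight\<close>.\<close>
  define x' q' where "x' = complex_of_real (norm x)" and "q' = complex_of_real (norm q)"
  have q': "norm q' < 1"
    using assms by (simp add: q'_def)
  have summ_l: "(\<lambda>ys. norm (q ^ sum_list ys)) summable_on parts 2 l" for l
    by (rule summable_on_subset_banach[OF abs_summable_on_lists[OF assms, of l]]) (auto simp: parts_def)
  have "(\<lambda>t. norm (case t of (l, ys) \<Rightarrow> x ^ l * q ^ sum_list ys)) summable_on (Sigma UNIV (parts 2))"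
    unfolding Infinite_Sum.abs_summable_on_Sigma_iff
  proof (intro conjI ballI)
    fix l :: nat
    show "(\<lambda>ys. norm (case (l, ys) of (l, ys) \<Rightarrow> x ^ l * q ^ sum_list ys)) summable_on parts 2 l"
      using summable_on_cmult_right[OF summ_l, of "norm (x ^ l)"] by (simp add: norm_mult)
  next
    have "norm (\<Sum>\<^sub>\<infinity>ys\<in>parts 2 l. norm (case (l, ys) of (l, ys) \<Rightarrow> x ^ l * q ^ sum_list ys))
        = norm (x' ^ l * nsum q' 0 0 0 l)" for l
    proof -
      have "(\<lambda>ys. norm q ^ sum_list ys) summable_on parts 2 l"
        using summ_l[of l] by (simp add: norm_power)
      from infsumI[OF has_sum_of_real[OF has_sum_infsum[OF this]]]
      have "psum q' 2 l = complex_of_real (\<Sum>\<^sub>\<infinity>ys\<in>parts 2 l. norm q ^ sum_list ys)"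
        by (simp add: q'_def psum_def)
      then have "x' ^ l * psum q' 2 l = complex_of_real (norm x ^ l * (\<Sum>\<^sub>\<infinity>ys\<in>parts 2 l. norm q ^ sum_list ys))"
        by (simp add: x'_def)
      then have "norm (x' ^ l * psum q' 2 l) = norm (norm x ^ l * (\<Sum>\<^sub>\<infinity>ys\<in>parts 2 l. norm q ^ sum_list ys))"
        by (simp only: norm_of_real real_norm_def)
      then show ?thesis
        by (simp add: psum_eq_nsum[OF q'] norm_mult norm_power infsum_cmult_right')
    qed
    then show "(\<lambda>l. norm (\<Sum>\<^sub>\<infinity>ys\<in>parts 2 l. norm (case (l, ys) of (l, ys) \<Rightarrow> x ^ l * q ^ sum_list ys))) summable_on UNIV"
      using abs_summable_by_weight[OF q', of x'] by simp
  qed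
  then have summ: "(\<lambda>(l, ys). x ^ l * q ^ sum_list ys) summable_on (Sigma UNIV (parts 2))"
    by (rule abs_summable_summable)
  have "((\<lambda>l. x ^ l * nsum q 0 0 0 l) has_sum (\<Sum>\<^sub>\<infinity>(l, ys)\<in>Sigma UNIV (parts 2). x ^ l * q ^ sum_list ys)) UNIV"
  proof (rule has_sum_Sigma'[OF has_sum_infsum[OF summ]])
    fix l
    have "((\<lambda>ys. q ^ sum_list ys) has_sum psum q 2 l) (parts 2 l)"
      unfolding psum_def by (intro has_sum_infsum summable_on_lists[OF assms, of _ l]) (auto simp: parts_def)
    from has_sum_cmult_right[OF this, of "x ^ l"]
    show "((\<lambda>ys. case (l, ys) of (l, ys) \<Rightarrow> x ^ l * q ^ sum_list ys) has_sum x ^ l * nsum q 0 0 0 l) (parts 2 l)"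
      by (simp add: psum_eq_nsum[OF assms])
  qed
  then have "(\<Sum>\<^sub>\<infinity>(l, ys)\<in>Sigma UNIV (parts 2). x ^ l * q ^ sum_list ys) = infsum (xterm x q) UNIV"
    by (rule has_sum_unique[OF _ has_sum_by_weight[OF assms]])
  then show ?thesis
    using has_sum_infsum[OF summ] by simp
qed

section \<open>Passing from lists to the counts \<open>B l n\<close>\<close>

lemma card_parts: "B l n = card {ys \<in> parts 2 l. sum_list ys = n}"
  unfolding B_def B_set_eq by (rule card_image) (simp add: inj_on_def)

lemma finite_parts: "finite {ys \<in> parts 2 l. sum_list ys = n}"
  by (rule finite_subset[OF _ finite_lists_length_eq[of "{..n}" l]])
     (auto simp: parts_def member_le_sum_list)

theorem theorem1p6:
  fixes x q :: complex
  assumes "norm q < 1"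
  shows "\<exists>S. ((\<lambda>(l, n). of_nat (B l n) * x ^ l * q ^ n) has_sum S) UNIV
           \<and> ((\<lambda>(N1, N2). q ^ (2 * (N1\<^sup>2 + N2\<^sup>2)) * qpoch_inf (- x * q ^ (1 + 2 * N2)) (q\<^sup>2)
                  * x ^ (N1 + N2) / (qpoch (q\<^sup>2) (q\<^sup>2) (N1 - N2) * qpoch (q\<^sup>2) (q\<^sup>2) N2))
              has_sum S) {(N1, N2). N2 \<le> N1}"
proof (intro exI conjI)
  show "((\<lambda>(N1, N2). q ^ (2 * (N1\<^sup>2 + N2\<^sup>2)) * qpoch_inf (- x * q ^ (1 + 2 * N2)) (q\<^sup>2)
                  * x ^ (N1 + N2) / (qpoch (q\<^sup>2) (q\<^sup>2) (N1 - N2) * qpoch (q\<^sup>2) (q\<^sup>2) N2))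
              has_sum infsum (xterm x q) UNIV) {(N1, N2). N2 \<le> N1}"
    by (rule has_sum_multisum[OF assms])
  let ?P = "\<lambda>(l, n). {ys \<in> parts 2 l. sum_list ys = n}"
  show "((\<lambda>(l, n). of_nat (B l n) * x ^ l * q ^ n) has_sum infsum (xterm x q) UNIV) UNIV"
  proof (rule has_sum_Sigma')
    \<comment> \<open>The lists of length l are grouped by their sum n; each fibre is finite and
      contributes \<open>B l n\<close> equal terms.\<close>
    have bij: "bij_betw (\<lambda>t. (fst (fst t), snd t)) (Sigma UNIV ?P) (Sigma UNIV (parts 2))"
      by (rule bij_betwI[where g = "\<lambda>(l, ys). ((l, sum_list ys), ys)"]) auto
    from has_sum_parts[OF assms]
    show "((\<lambda>t. case (fst (fst t), snd t) of (l, ys) \<Rightarrow> x ^ l * q ^ sum_list ys)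
        has_sum infsum (xterm x q) UNIV) (Sigma UNIV ?P)"
      by (rule iffD2[OF has_sum_reindex_bij_betw[OF bij]])
  next
    fix ln :: "nat \<times> nat"
    obtain l n where ln: "ln = (l, n)" by fastforce
    have "(\<Sum>ys\<in>?P (l, n). x ^ l * q ^ sum_list ys) = (\<Sum>ys\<in>?P (l, n). x ^ l * q ^ n)"
      by (rule sum.cong) auto
    then have "of_nat (B l n) * x ^ l * q ^ n = (\<Sum>ys\<in>?P (l, n). x ^ l * q ^ sum_list ys)"
      by (simp only: prod.case card_parts sum_constant mult.assoc)
    then show "((\<lambda>ys. case (fst (fst (ln, ys)), snd (ln, ys)) of (l, ys) \<Rightarrow> x ^ l * q ^ sum_list ys)
        has_sum (case ln of (l, n) \<Rightarrow> of_nat (B l n) * x ^ l * q ^ n)) (?P ln)"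
      unfolding ln prod.case fst_conv snd_conv by (rule has_sum_finiteI[OF finite_parts])
  qed
qed

end
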